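(* $\frac{1}{2}\log 3 \leq \xi_m(2) \leq \log 2$.
   Context: All graphs are finite and simple. For a bipartite graph $G$ with bipartition $V = A \sqcup B$ and positive integers $k_A, k_B$, $G$ is $(k_A,k_B)$-choosable if for every set of colors $C$ and every list assignment $L$ assigning to each vertex of $A$ a $k_A$-element subset of $C$ and to each vertex of $B$ a $k_B$-element subset of $C$, there is a map $c\colon V\to C$ with $c(v)\in L(v)$ for all $v$ and $c(v)\neq c(v')$ for every edge $vv'$. For the complete bipartite graph $K_{\Delta_B,\Delta_A}$ the part $A$ has $\Delta_B$ vertices and the part $B$ has $\Delta_A$ vertices. $\log$ is the natural logarithm. For a positive integer $k_A$, $\xi_m(k_A)$ is the infimum of $\Delta_B(\log\Delta_A)^{k_A-1}/k_B^{k_A}$ over all positive integers $\Delta_A,\Delta_B,k_B$ such that $K_{\Delta_B,\Delta_A}$ is not $(k_A,k_B)$-choosable. *)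

theory Defs
  imports Complex_Main "HOL-Library.Ramsey"
begin

definition bipartite_graph :: "'v set \<Rightarrow> 'v set \<Rightarrow> 'v set set \<Rightarrow> bool" where
  "bipartite_graph A B E \<longleftrightarrow>
     finite A \<and> finite B \<and> A \<inter> B = {} \<and> E \<subseteq> {{a, b} | a b. a \<in> A \<and> b \<in> B}"

text \<open>Here \<open>[C]\<^bsup>k\<^esup>\<close> is \<open>nsets C k\<close>, the set of all \<open>k\<close>-element subsets of \<open>C\<close>.  The argument
  of type \<open>'c itself\<close> fixes the type from which the colours are drawn.\<close>

definition choosable_over ::
  "'c itself \<Rightarrow> 'v set \<Rightarrow> 'v set \<Rightarrow> 'v set set \<Rightarrow> nat \<Rightarrow> nat \<Rightarrow> bool" where
  "choosable_over _ A B E k\<^sub>A k\<^sub>B \<longleftrightarrow>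
     (\<forall>(C :: 'c set) (L :: 'v \<Rightarrow> 'c set).
        (\<forall>v\<in>A. L v \<in> [C]\<^bsup>k\<^sub>A\<^esup>) \<and> (\<forall>v\<in>B. L v \<in> [C]\<^bsup>k\<^sub>B\<^esup>) \<longrightarrow>
        (\<exists>c :: 'v \<Rightarrow> 'c. (\<forall>v\<in>A \<union> B. c v \<in> L v) \<and>
                         (\<forall>v v'. {v, v'} \<in> E \<longrightarrow> c v \<noteq> c v')))"

text \<open>Choosability quantifies over all sets of colours.  A finite graph only ever uses finitely
  many colours, so taking the colours to be natural numbers loses nothing; this is
  \<open>choosable_imp_choosable_over\<close> below.\<close>

definition choosable :: "'v set \<Rightarrow> 'v set \<Rightarrow> 'v set set \<Rightarrow> nat \<Rightarrow> nat \<Rightarrow> bool" where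
  "choosable A B E k\<^sub>A k\<^sub>B \<longleftrightarrow> choosable_over TYPE(nat) A B E k\<^sub>A k\<^sub>B"

lemma choosable_imp_choosable_over:
  fixes A B :: "'v set"
  assumes G: "bipartite_graph A B E" and ch: "choosable A B E k\<^sub>A k\<^sub>B"
  shows "choosable_over TYPE('c) A B E k\<^sub>A k\<^sub>B"
  unfolding choosable_over_def
proof (intro allI impI, elim conjE)
  fix C :: "'c set" and L :: "'v \<Rightarrow> 'c set"
  assume LA: "\<forall>v\<in>A. L v \<in> [C]\<^bsup>k\<^sub>A\<^esup>" and LB: "\<forall>v\<in>B. L v \<in> [C]\<^bsup>k\<^sub>B\<^esup>"
  define D where "D = (\<Union>v\<in>A \<union> B. L v)"
  have "finite D"
    using G LA LB by (auto simp: D_def bipartite_graph_def nsets_def)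
  then obtain f :: "'c \<Rightarrow> nat" where inj: "inj_on f D"
    by (metis finite_imp_inj_to_nat_seg)
  have sub: "L v \<subseteq> D" if "v \<in> A \<union> B" for v
    using that by (auto simp: D_def)
  have card: "card (f ` L v) = card (L v)" if "v \<in> A \<union> B" for v
    using inj_on_subset[OF inj sub[OF that]] by (rule card_image)
  have lists: "(\<forall>v\<in>A. f ` L v \<in> [UNIV]\<^bsup>k\<^sub>A\<^esup>) \<and> (\<forall>v\<in>B. f ` L v \<in> [UNIV]\<^bsup>k\<^sub>B\<^esup>)"
    using LA LB card by (auto simp: nsets_def)
  have "\<exists>c. (\<forall>v\<in>A \<union> B. c v \<in> f ` L v) \<and> (\<forall>v v'. {v, v'} \<in> E \<longrightarrow> c v \<noteq> c v')"
    by (rule ch[unfolded choosable_def choosable_over_def, THEN spec, THEN spec, THEN mp, OF lists])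
  then obtain c where c: "\<forall>v\<in>A \<union> B. c v \<in> f ` L v"
    and proper: "\<forall>v v'. {v, v'} \<in> E \<longrightarrow> c v \<noteq> c v'"
    by (elim exE conjE)
  from c have "\<forall>v\<in>A \<union> B. \<exists>x\<in>L v. c v = f x" by blast
  then obtain d where d: "\<forall>v\<in>A \<union> B. d v \<in> L v \<and> c v = f (d v)" by metis
  have "d v \<noteq> d v'" if "{v, v'} \<in> E" for v v'
  proof -
    from that G obtain a b where "{v, v'} = {a, b}" "a \<in> A" "b \<in> B"
      unfolding bipartite_graph_def by blast
    then have "v \<in> A \<union> B" "v' \<in> A \<union> B"
      by (auto simp: doubleton_eq_iff)
    with d proper that show ?thesis by metis
  qed
  with d show "\<exists>c. (\<forall>v\<in>A \<union> B. c v \<in> L v) \<and> (\<forall>v v'. {v, v'} \<in> E \<longrightarrow> c v \<noteq> c v')"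
    by blast
qed

text \<open>The complete bipartite graph \<open>K\<^bsub>m,n\<^esub>\<close>, whose part \<open>A\<close> has \<open>m\<close> and whose part \<open>B\<close> has
  \<open>n\<close> vertices.\<close>

definition K_A :: "nat \<Rightarrow> (nat + nat) set" where
  "K_A m = Inl ` {..<m}"

definition K_B :: "nat \<Rightarrow> (nat + nat) set" where
  "K_B n = Inr ` {..<n}"

definition K_edges :: "nat \<Rightarrow> nat \<Rightarrow> (nat + nat) set set" where
  "K_edges m n = {{a, b} | a b. a \<in> K_A m \<and> b \<in> K_B n}"

lemma complete_bipartite_graph: "bipartite_graph (K_A m) (K_B n) (K_edges m n)"
  by (auto simp: bipartite_graph_def K_A_def K_B_def K_edges_def)

definition K_choosable :: "nat \<Rightarrow> nat \<Rightarrow> nat \<Rightarrow> nat \<Rightarrow> bool" where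
  "K_choosable m n k\<^sub>A k\<^sub>B \<longleftrightarrow> choosable (K_A m) (K_B n) (K_edges m n) k\<^sub>A k\<^sub>B"

definition xi_m_values :: "nat \<Rightarrow> real set" where
  "xi_m_values k\<^sub>A =
     {real \<Delta>\<^sub>B * ln (real \<Delta>\<^sub>A) ^ (k\<^sub>A - 1) / real k\<^sub>B ^ k\<^sub>A | \<Delta>\<^sub>A \<Delta>\<^sub>B k\<^sub>B.
        \<Delta>\<^sub>A > 0 \<and> \<Delta>\<^sub>B > 0 \<and> k\<^sub>B > 0 \<and> \<not> K_choosable \<Delta>\<^sub>B \<Delta>\<^sub>A k\<^sub>A k\<^sub>B}"

definition xi_m :: "nat \<Rightarrow> real" where
  "xi_m k\<^sub>A = Inf (xi_m_values k\<^sub>A)"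

text \<open>The infimum is a genuine one, i.e. not taken over an empty or unbounded set of reals.\<close>

lemma bdd_below_xi_m_values: "bdd_below (xi_m_values k\<^sub>A)"
  by (rule bdd_belowI[of _ 0]) (auto simp: xi_m_values_def)

lemma xi_m_values_nonempty:
  assumes "k\<^sub>A > 0"
  shows "xi_m_values k\<^sub>A \<noteq> {}"
proof -
  define L :: "nat + nat \<Rightarrow> nat set" where
    "L = case_sum (\<lambda>_. {..<k\<^sub>A}) (\<lambda>j. {j})"
  have "\<not> K_choosable 1 k\<^sub>A k\<^sub>A 1"
  proof
    assume ch: "K_choosable 1 k\<^sub>A k\<^sub>A 1"
    have lists: "(\<forall>v\<in>K_A 1. L v \<in> [UNIV]\<^bsup>k\<^sub>A\<^esup>) \<and> (\<forall>v\<in>K_B k\<^sub>A. L v \<in> [UNIV]\<^bsup>1\<^esup>)"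
      by (auto simp: K_A_def K_B_def L_def nsets_def)
    have "\<exists>c. (\<forall>v\<in>K_A 1 \<union> K_B k\<^sub>A. c v \<in> L v) \<and>
              (\<forall>v v'. {v, v'} \<in> K_edges 1 k\<^sub>A \<longrightarrow> c v \<noteq> c v')"
      by (rule ch[unfolded K_choosable_def choosable_def choosable_over_def,
            THEN spec, THEN spec, THEN mp, OF lists])
    then obtain c where c: "\<forall>v\<in>K_A 1 \<union> K_B k\<^sub>A. c v \<in> L v"
      and proper: "\<forall>v v'. {v, v'} \<in> K_edges 1 k\<^sub>A \<longrightarrow> c v \<noteq> c v'"
      by (elim exE conjE)
    define j where "j = c (Inl 0)"
    have "c (Inl 0) \<in> L (Inl 0)" using c by (simp add: K_A_def)
    then have "j < k\<^sub>A" by (simp add: j_def L_def)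
    then have "c (Inr j) \<in> L (Inr j)" using c by (simp add: K_B_def)
    then have "c (Inr j) = j" by (simp add: L_def)
    moreover have "{Inl 0, Inr j} \<in> K_edges 1 k\<^sub>A"
      using \<open>j < k\<^sub>A\<close> unfolding K_edges_def K_A_def K_B_def by blast
    ultimately show False
      using proper by (metis j_def)
  qed
  with assms show ?thesis unfolding xi_m_values_def by blast
qed

end

theory Submission
  imports Defs
begin

text \<open>Regard the colours as vertices of a graph whose edges are the 2-element lists on \<open>A\<close>; a proper
  colouring exists iff some independent set of this graph meets all the \<open>k\<close>-element lists on \<open>B\<close>.
  Let there be \<open>m\<close> edges and \<open>n\<close> lists on \<open>B\<close>, where \<open>2 m ln n < k\<^sup>2 ln 3\<close>.  A vertex of degree at least
  \<open>2 m / k\<close> can be discarded, which lowers \<open>k\<close> by one.  If there is none, order the vertices at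
  random and take the vertices preceding all their neighbours.  A fixed \<open>k\<close>-set is missed with
  probability at most \<open>3 powr (- k\<^sup>2 / (2 m))\<close>, so a union bound applies.  That probability is bounded
  through an exponential potential of the part of the \<open>k\<close>-set that is not yet adjacent to a drawn
  vertex; the potential does not increase on average when the next vertex is drawn, so the vertices
  can be drawn one by one keeping the total potential of the lists below 1.  The value \<open>ln 2\<close> is
  attained by \<open>K\<^bsub>1,2\<^esub>\<close> with \<open>k = 1\<close>.\<close>

section \<open>Edge sets, neighbourhoods and the potential\<close>

definition nbrs :: "'a set set \<Rightarrow> 'a \<Rightarrow> 'a set" where
  "nbrs E u = {v. {u, v} \<in> E}"

definition touching :: "'a set set \<Rightarrow> 'a set \<Rightarrow> 'a set set" where
  "touching E U = {e \<in> E. e \<inter> U \<noteq> {}}"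

definition independent :: "'a set set \<Rightarrow> 'a set \<Rightarrow> bool" where
  "independent E I \<longleftrightarrow> (\<forall>e\<in>E. \<not> e \<subseteq> I)"

text \<open>The exponent is, up to sign, the tangent at \<open>m = k / r\<close> of the convex function
  \<open>m \<mapsto> (r / 2) k ln (1 + 2 k / (r m))\<close> of the number \<open>m\<close> of touching edges, where \<open>k = card U\<close>.\<close>

definition pot :: "real \<Rightarrow> 'a set set \<Rightarrow> 'a set \<Rightarrow> real" where
  "pot r E U = exp (r\<^sup>2 / 3 * card (touching E U) - r * (ln 3 + 2/3) / 2 * card U)"

lemma nbrs_sym: "v \<in> nbrs E u \<longleftrightarrow> u \<in> nbrs E v"
  by (simp add: nbrs_def insert_commute)

lemma finite_nbrs:
  assumes "finite E"
  shows "finite (nbrs E u)"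
proof -
  have "inj_on (\<lambda>v. {u, v}) (nbrs E u)"
    by (auto simp: inj_on_def doubleton_eq_iff)
  moreover have "(\<lambda>v. {u, v}) ` nbrs E u \<subseteq> E"
    by (auto simp: nbrs_def)
  ultimately show ?thesis
    using assms by (meson inj_on_finite)
qed

lemma card_touching_singleton:
  assumes "\<forall>e\<in>E. card e = 2"
  shows "card (touching E {v}) = card (nbrs E v)"
proof -
  have "bij_betw (\<lambda>u. {v, u}) (nbrs E v) (touching E {v})"
    unfolding bij_betw_def
  proof (intro conjI set_eqI iffI)
    show "inj_on (\<lambda>u. {v, u}) (nbrs E v)"
      by (auto simp: inj_on_def doubleton_eq_iff)
  next
    fix e assume "e \<in> (\<lambda>u. {v, u}) ` nbrs E v"
    then show "e \<in> touching E {v}"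
      by (auto simp: touching_def nbrs_def)
  next
    fix e assume e: "e \<in> touching E {v}"
    then obtain a b where ab: "e = {a, b}"
      using assms by (auto simp: touching_def card_2_iff)
    then obtain u where "e = {v, u}"
      using e by (auto simp: touching_def)
    then show "e \<in> (\<lambda>u. {v, u}) ` nbrs E v"
      using e by (auto simp: touching_def nbrs_def)
  qed
  then show ?thesis
    by (simp add: bij_betw_same_card)
qed

section \<open>Two inequalities for the exponential function\<close>

text \<open>Jensen's inequality for the \<open>card X\<close> numbers \<open>D * c u\<close> and the number \<open>0\<close> with weight
  \<open>D - card X\<close>.\<close>

lemma exp_sum_le:
  fixes c :: "'a \<Rightarrow> real"
  assumes "finite X" "real (card X) \<le> D" "D > 0"
  shows "exp (\<Sum>u\<in>X. c u) - 1 \<le> (\<Sum>u\<in>X. (exp (D * c u) - 1) / D)"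
proof -
  define s where "s = (\<Sum>u\<in>X. c u)"
  have tangent: "exp s * (1 + t - s) \<le> exp t" for t
  proof -
    have "1 + (t - s) \<le> exp (t - s)" by (rule exp_ge_add_one_self)
    then have "exp s * (1 + (t - s)) \<le> exp s * exp (t - s)" by simp
    then show ?thesis by (simp add: exp_add[symmetric] algebra_simps)
  qed
  \<comment> \<open>The linear terms cancel because the weighted mean of the points is
    \<open>s\<close>.\<close>
  have "D * exp s = (\<Sum>u\<in>X. exp s * (1 + D * c u - s)) + (D - card X) * (exp s * (1 + 0 - s))"
    by (simp add: sum_distrib_left[symmetric] sum.distrib sum_subtractf s_def[symmetric])
       (simp add: algebra_simps)
  also have "\<dots> \<le> (\<Sum>u\<in>X. exp (D * c u)) + (D - card X) * exp 0"
    using assms by (intro add_mono sum_mono mult_left_mono tangent) auto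
  finally have "D * (exp s - 1) \<le> (\<Sum>u\<in>X. exp (D * c u) - 1)"
    by (simp add: sum_subtractf algebra_simps)
  then show ?thesis
    using \<open>D > 0\<close> by (simp add: s_def sum_divide_distrib[symmetric] field_simps)
qed

text \<open>With \<open>y = 2/3 * (q - 1)\<close> this follows from \<open>1 + y \<le> exp y\<close>
  and \<open>y * y \<ge> 0\<close>, with equality at \<open>q = 1\<close>. It is what fixes the
  constants of \<open>pot\<close>.\<close>

lemma three_exp_le:
  fixes q :: real
  assumes "q \<ge> 0"
  shows "q * (3 * exp (2/3 * (1 - q)) - 1) \<le> 2"
proof -
  define y where "y = 2/3 * (q - 1)"
  have q: "q = 1 + 3/2 * y" and y: "y \<ge> - 2/3"
    using assms by (auto simp: y_def field_simps)
  have "2 + 3 * y \<le> (1 + y) * (2 + y)"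
    by (simp add: algebra_simps)
  also have "\<dots> \<le> exp y * (2 + y)"
    using y exp_ge_add_one_self[of y] by (intro mult_right_mono) auto
  finally have "exp (-y) * (2 + 3 * y) \<le> exp (-y) * (exp y * (2 + y))"
    by (intro mult_left_mono) auto
  also have "\<dots> = 2 + y"
    by (simp add: exp_minus)
  finally have "exp (-y) * (2 + 3 * y) \<le> 2 + y" .
  moreover have "2/3 * (1 - q) = -y"
    by (simp add: y_def field_simps)
  moreover have "q * (3 * exp (- y) - 1) = 3/2 * (exp (-y) * (2 + 3 * y)) - q"
    by (simp add: q algebra_simps diff_divide_distrib)
  ultimately show ?thesis
    using q by simp
qed

section \<open>Change of the potential when one vertex is drawn\<close>

text \<open>An edge from \<open>u \<in> X\<close> to a vertex outside \<open>U\<close> touches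
  \<open>U\<close> but not \<open>U - X\<close>, and it determines \<open>u\<close>. Edges inside
  \<open>X\<close> are lost as well, but are not counted.\<close>

lemma card_touching_diff:
  assumes E: "finite E" "\<forall>e\<in>E. card e = 2" and X: "X \<subseteq> U" "finite U"
  shows "card (touching E (U - X)) + (\<Sum>u\<in>X. card (nbrs E u - U)) \<le> card (touching E U)"
proof -
  define P where "P u = (\<lambda>v. {u, v}) ` (nbrs E u - U)" for u
  have fin: "finite X" using X finite_subset by blast
  have cP: "card (P u) = card (nbrs E u - U)" for u
    unfolding P_def by (rule card_image) (auto simp: inj_on_def doubleton_eq_iff)
  have finP: "finite (P u)" for u
    using finite_nbrs[OF E(1)] by (simp add: P_def)
  have "P u \<inter> P v = {}" if "u \<in> X" "v \<in> X" "u \<noteq> v" for u v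
    using that X by (auto simp: P_def doubleton_eq_iff)
  then have "card (\<Union>u\<in>X. P u) = (\<Sum>u\<in>X. card (nbrs E u - U))"
    using fin finP by (subst card_UN_disjoint) (auto simp: cP)
  moreover have "touching E (U - X) \<inter> (\<Union>u\<in>X. P u) = {}"
    by (auto simp: touching_def P_def)
  moreover have "touching E (U - X) \<union> (\<Union>u\<in>X. P u) \<subseteq> touching E U"
    using X by (auto simp: touching_def P_def nbrs_def)
  moreover have finT: "finite (touching E V)" for V
    using E by (simp add: touching_def)
  ultimately show ?thesis
    using fin finP
    by (metis card_Un_disjoint card_mono finT finite_UN_I)
qed

lemma pot_diff_le:
  assumes E: "finite E" "\<forall>e\<in>E. card e = 2" and X: "X \<subseteq> U" "finite U"
    and r: "r > 0" "r * real (card X) \<le> 2"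
  shows "pot r E (U - X) - pot r E U
    \<le> pot r E U * (\<Sum>u\<in>X. (3 * exp (2/3 * (1 - r * card (nbrs E u - U))) - 1) * r / 2)"
proof -
  \<comment> \<open>With this \<open>D\<close> the term \<open>r * ln 3 / 2\<close> of the exponent
    turns into the factor 3, and \<open>r(2)\<close> becomes the weight condition of
    \<open>exp_sum_le\<close>.\<close>
  define D where "D = 2 / r"
  define c where "c u = r * (ln 3 + 2/3) / 2 - r\<^sup>2 / 3 * card (nbrs E u - U)" for u
  have fin: "finite X" using X finite_subset by blast
  have D: "D > 0" "card X \<le> D"
    using r by (auto simp: D_def field_simps)
  have exp_c: "exp (D * c u) = 3 * exp (2/3 * (1 - r * card (nbrs E u - U)))" for u
  proof -
    have "D * c u = ln 3 + 2/3 * (1 - r * card (nbrs E u - U))"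
      using r by (simp add: D_def c_def field_simps power2_eq_square)
    then show ?thesis by (simp add: exp_add)
  qed
  have "card (U - X) + card X = card U"
    using X fin by (simp add: card_Diff_subset card_mono)
  then have cU: "real (card (U - X)) = card U - real (card X)"
    by linarith
  define a where "a = r * (ln 3 + 2/3) / 2"
  have "real (card (touching E (U - X))) + (\<Sum>u\<in>X. real (card (nbrs E u - U))) \<le> card (touching E U)"
    using card_touching_diff[OF E X] by (metis of_nat_add of_nat_le_iff of_nat_sum)
  then have "r\<^sup>2 / 3 * (card (touching E (U - X)) + (\<Sum>u\<in>X. real (card (nbrs E u - U))))
      \<le> r\<^sup>2 / 3 * card (touching E U)"
    by (intro mult_left_mono) auto
  then have "r\<^sup>2 / 3 * card (touching E (U - X)) - a * card (U - X)
    \<le> (r\<^sup>2 / 3 * card (touching E U) - a * card U) + (\<Sum>u\<in>X. c u)"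
    unfolding cU c_def sum_subtractf sum_distrib_left[symmetric] a_def[symmetric]
    by (simp add: algebra_simps)
  then have "pot r E (U - X) \<le> pot r E U * exp (\<Sum>u\<in>X. c u)"
    by (simp add: pot_def exp_add[symmetric] a_def)
  then have "pot r E (U - X) - pot r E U \<le> pot r E U * (exp (\<Sum>u\<in>X. c u) - 1)"
    by (simp add: algebra_simps)
  also have "\<dots> \<le> pot r E U * (\<Sum>u\<in>X. (exp (D * c u) - 1) / D)"
    using exp_sum_le[OF fin D(2,1)] by (intro mult_left_mono) (auto simp: pot_def)
  finally show ?thesis
    unfolding exp_c by (simp add: D_def)
qed

text \<open>A vertex \<open>u\<close> of \<open>U\<close> is removed by exactly
  \<open>card (nbrs E u - U)\<close> of the choices \<open>w \<in> R - U\<close>, so by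
  \<open>three_exp_le\<close> it contributes a total increase of at most \<open>pot r E U\<close>.
  The \<open>card U\<close> choices \<open>w \<in> U\<close>, which meet the list and count as 0,
  pay for this.\<close>

lemma sum_pot_step:
  assumes E: "finite E" "\<forall>e\<in>E. card e = 2" and R: "finite R" "U \<subseteq> R"
    and nb: "\<forall>u\<in>U. nbrs E u \<subseteq> R"
    and r: "r > 0" "\<forall>v. r * real (card (nbrs E v)) \<le> 2"
  shows "(\<Sum>w\<in>R - U. pot r E (U - nbrs E w)) \<le> card R * pot r E U"
proof -
  define f where "f u = (3 * exp (2/3 * (1 - r * card (nbrs E u - U))) - 1) * r / 2" for u
  have finU: "finite U" using R finite_subset by blast
  have step: "pot r E (U - nbrs E w) - pot r E U \<le> pot r E U * (\<Sum>u\<in>nbrs E w \<inter> U. f u)" for w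
  proof -
    have "card (nbrs E w \<inter> U) \<le> card (nbrs E w)"
      by (intro card_mono finite_nbrs E) auto
    then have "r * card (nbrs E w \<inter> U) \<le> r * card (nbrs E w)"
      using r by (intro mult_left_mono) auto
    then have "r * card (nbrs E w \<inter> U) \<le> 2"
      using r by (meson order_trans)
    from pot_diff_le[OF E _ finU r(1) this] show ?thesis
      by (simp add: f_def Diff_Int)
  qed
  have swap: "(\<Sum>w\<in>R - U. \<Sum>u\<in>nbrs E w \<inter> U. f u) = (\<Sum>u\<in>U. card (nbrs E u - U) * f u)"
  proof -
    have "(\<Sum>w\<in>R - U. \<Sum>u\<in>nbrs E w \<inter> U. f u) = (\<Sum>w\<in>R - U. \<Sum>u | u \<in> U \<and> u \<in> nbrs E w. f u)"
      by (intro sum.cong) auto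
    also have "\<dots> = (\<Sum>u\<in>U. \<Sum>w | w \<in> R - U \<and> u \<in> nbrs E w. f u)"
      using R finU by (intro sum.swap_restrict) auto
    also have "\<dots> = (\<Sum>u\<in>U. card (nbrs E u - U) * f u)"
    proof (intro sum.cong refl)
      fix u assume "u \<in> U"
      then have "{w. w \<in> R - U \<and> u \<in> nbrs E w} = nbrs E u - U"
        using nb by (auto simp: nbrs_sym)
      then show "(\<Sum>w | w \<in> R - U \<and> u \<in> nbrs E w. f u) = card (nbrs E u - U) * f u"
        by simp
    qed
    finally show ?thesis .
  qed
  have "card (nbrs E u - U) * f u \<le> 1" for u
    using three_exp_le[of "r * card (nbrs E u - U)"] r by (simp add: f_def field_simps)
  then have le: "(\<Sum>u\<in>U. card (nbrs E u - U) * f u) \<le> card U"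
    using sum_mono[of U "\<lambda>u. card (nbrs E u - U) * f u" "\<lambda>_. 1"] by simp
  have "(\<Sum>w\<in>R - U. pot r E (U - nbrs E w)) - card (R - U) * pot r E U
      = (\<Sum>w\<in>R - U. pot r E (U - nbrs E w) - pot r E U)"
    by (simp add: sum_subtractf)
  also have "\<dots> \<le> (\<Sum>w\<in>R - U. pot r E U * (\<Sum>u\<in>nbrs E w \<inter> U. f u))"
    by (intro sum_mono step)
  also have "\<dots> \<le> pot r E U * card U"
    unfolding sum_distrib_left[symmetric] swap
    using le by (intro mult_left_mono) (auto simp: pot_def)
  finally have "(\<Sum>w\<in>R - U. pot r E (U - nbrs E w)) \<le> (card (R - U) + card U) * pot r E U"
    by (simp add: algebra_simps)
  also have "card (R - U) + card U = card R"
    using R finU by (simp add: card_Diff_subset card_mono)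
  finally show ?thesis .
qed

section \<open>Drawing all vertices one by one\<close>

text \<open>\<open>R\<close> holds the vertices still to be drawn, \<open>W\<close> those that may still enter the independent
  set, and \<open>U j\<close> the part of the \<open>j\<close>-th list that lies in \<open>W\<close>.\<close>

lemma independent_transversal_pot:
  assumes E: "finite E" "\<forall>e\<in>E. card e = 2" and J: "finite J"
    and R: "finite R" "W \<subseteq> R" "\<forall>u\<in>W. nbrs E u \<subseteq> R"
    and U: "\<forall>j\<in>J. U j \<subseteq> W"
    and r: "r > 0" "\<forall>v. r * real (card (nbrs E v)) \<le> 2"
    and small: "(\<Sum>j\<in>J. pot r E (U j)) < 1"
  shows "\<exists>I\<subseteq>W. independent E I \<and> (\<forall>j\<in>J. I \<inter> U j \<noteq> {})"
  using J R U small
proof (induction "card R" arbitrary: R W U J)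
  case 0
  \<comment> \<open>Every remaining list is empty and has potential 1, so a total below 1 leaves no
    list.\<close>
  then have "W = {}" by auto
  with 0 have "(\<Sum>j\<in>J. pot r E (U j)) = (\<Sum>j\<in>J. 1)"
    by (intro sum.cong) (auto simp: pot_def touching_def)
  with 0 have "J = {}" by auto
  moreover have "independent E {}"
    using E by (auto simp: independent_def)
  ultimately show ?case by blast
next
  case (Suc n)
  \<comment> \<open>The total potential after drawing \<open>w\<close>: lists containing
    \<open>w\<close> are met and drop out, the others lose the neighbours of \<open>w\<close>. Its
    average over \<open>R\<close> is below 1.\<close>
  define g where "g w = (\<Sum>j | j \<in> J \<and> w \<notin> U j. pot r E (U j - nbrs E w))" for w
  have "(\<Sum>w\<in>R. g w) = (\<Sum>j\<in>J. \<Sum>w | w \<in> R \<and> w \<notin> U j. pot r E (U j - nbrs E w))"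
    unfolding g_def using Suc.prems by (intro sum.swap_restrict) auto
  also have "\<dots> \<le> (\<Sum>j\<in>J. card R * pot r E (U j))"
  proof (intro sum_mono)
    fix j assume "j \<in> J"
    then have "U j \<subseteq> R" "\<forall>u\<in>U j. nbrs E u \<subseteq> R"
      using Suc.prems(3-5) by blast+
    then have "(\<Sum>w\<in>R - U j. pot r E (U j - nbrs E w)) \<le> card R * pot r E (U j)"
      using Suc.prems(2) by (intro sum_pot_step[OF E _ _ _ r]) auto
    moreover have "{w. w \<in> R \<and> w \<notin> U j} = R - U j" by auto
    ultimately show "(\<Sum>w | w \<in> R \<and> w \<notin> U j. pot r E (U j - nbrs E w)) \<le> card R * pot r E (U j)"
      by simp
  qed
  also have "\<dots> < (\<Sum>w\<in>R. 1)"
    using Suc.prems(6) Suc.hyps(2) by (simp add: sum_distrib_left[symmetric])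
  finally obtain w where w: "w \<in> R" "g w < 1"
    by (meson not_less sum_mono)
  \<comment> \<open>The neighbours of \<open>w\<close> are excluded even if \<open>w\<close> itself
    is not in \<open>W\<close>, as they no longer precede all their neighbours.\<close>
  define W' where "W' = W - {w} - nbrs E w"
  define J' where "J' = {j \<in> J. w \<notin> U j}"
  have "\<exists>I\<subseteq>W'. independent E I \<and> (\<forall>j\<in>J'. I \<inter> (U j - nbrs E w) \<noteq> {})"
  proof (rule Suc.hyps(1))
    show "n = card (R - {w})" using Suc.hyps(2) w by simp
    show "finite J'" "finite (R - {w})" "W' \<subseteq> R - {w}"
      using Suc.prems by (auto simp: J'_def W'_def)
    show "\<forall>u\<in>W'. nbrs E u \<subseteq> R - {w}"
      using Suc.prems(4) by (auto simp: W'_def nbrs_sym)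
    show "\<forall>j\<in>J'. U j - nbrs E w \<subseteq> W'"
      using Suc.prems(5) by (auto simp: W'_def J'_def)
    show "(\<Sum>j\<in>J'. pot r E (U j - nbrs E w)) < 1"
      using w by (simp add: g_def J'_def)
  qed
  then obtain I where I: "I \<subseteq> W'" "independent E I" "\<forall>j\<in>J'. I \<inter> (U j - nbrs E w) \<noteq> {}"
    by (elim exE conjE)
  show ?case
  proof (cases "w \<in> W")
    case False
    then have "J' = J" using Suc.prems(5) by (auto simp: J'_def)
    then have "\<forall>j\<in>J. I \<inter> U j \<noteq> {}" using I(3) by blast
    moreover have "I \<subseteq> W" using I(1) by (auto simp: W'_def)
    ultimately show ?thesis using I(2) by blast
  next
    case True
    have "independent E (insert w I)"
      unfolding independent_def
    proof (intro ballI notI)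
      fix e assume e: "e \<in> E" "e \<subseteq> insert w I"
      then have "w \<in> e" using I(2) by (auto simp: independent_def)
      moreover from e obtain a b where "e = {a, b}" "a \<noteq> b"
        using E(2) by (auto simp: card_2_iff)
      ultimately obtain u where "e = {w, u}" "u \<noteq> w" by auto
      then have "u \<in> I" "u \<in> nbrs E w" using e by (auto simp: nbrs_def)
      then show False using I(1) by (auto simp: W'_def)
    qed
    moreover have "\<forall>j\<in>J. insert w I \<inter> U j \<noteq> {}"
    proof
      fix j assume "j \<in> J"
      then show "insert w I \<inter> U j \<noteq> {}"
        using I(3) by (cases "w \<in> U j") (auto simp: J'_def)
    qed
    moreover have "insert w I \<subseteq> W" using True I(1) by (auto simp: W'_def)
    ultimately show ?thesis by blast
  qed
qed

section \<open>Removal of vertices of large degree\<close>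

lemma independent_transversal:
  fixes S :: "'b \<Rightarrow> 'a set"
  assumes E: "finite E" "\<forall>e\<in>E. card e = 2" and J: "finite J" "J \<noteq> {}"
    and S: "\<forall>j\<in>J. finite (S j) \<and> card (S j) = k"
    and small: "2 * real (card E) * ln (real (card J)) < real k ^ 2 * ln 3"
  shows "\<exists>I. independent E I \<and> (\<forall>j\<in>J. I \<inter> S j \<noteq> {})"
  using E S small
proof (induction k arbitrary: E S)
  case 0
  have "ln (real (card J)) \<ge> 0"
    using J by (simp add: Suc_leI card_gt_0_iff)
  then have "2 * real (card E) * ln (real (card J)) \<ge> 0"
    by (intro mult_nonneg_nonneg) auto
  with 0 show ?case by simp
next
  case (Suc k E S)
  define m where "m = card E"
  define l where "l = ln (real (card J))"
  have l0: "l \<ge> 0"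
    using J by (simp add: l_def Suc_leI card_gt_0_iff)
  have small: "2 * real m * l < real (Suc k) ^ 2 * ln 3"
    using Suc.prems(4) by (simp add: m_def l_def)
  show ?case
  proof (cases "m = 0")
    case True
    then have "E = {}" using Suc.prems by (simp add: m_def)
    moreover have "\<forall>j\<in>J. UNIV \<inter> S j \<noteq> {}"
      using Suc.prems(3) by fastforce
    ultimately show ?thesis by (intro exI[of _ UNIV]) (auto simp: independent_def)
  next
    case False
    then have m: "real m > 0" by simp
    show ?thesis
    proof (cases "\<exists>v. Suc k * card (nbrs E v) \<ge> 2 * m")
      case True
      then obtain v where v: "Suc k * card (nbrs E v) \<ge> 2 * m" by blast
      \<comment> \<open>Keeping \<open>v\<close> out of the independent set does not decrease \<open>k\<^sup>2 / m\<close>.\<close>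
      define E' where "E' = E - touching E {v}"
      have sub: "touching E {v} \<subseteq> E" by (auto simp: touching_def)
      have deg: "card (nbrs E v) \<le> m"
        unfolding m_def card_touching_singleton[OF Suc.prems(2), symmetric]
        using Suc.prems(1) sub by (rule card_mono)
      have cE': "real (card E') = m - real (card (nbrs E v))"
        using sub Suc.prems(1) deg
        by (simp add: E'_def card_Diff_subset finite_subset card_touching_singleton[OF Suc.prems(2)]
            m_def of_nat_diff)
      \<comment> \<open>Otherwise the degree of \<open>v\<close> would be at least
        \<open>2 * m\<close>. Positivity keeps the multiplication by \<open>k^2\<close> below
        strict.\<close>
      have k: "k > 0"
      proof (rule ccontr)
        assume "\<not> k > 0"
        with v deg False show False by simp
      qed
      have "\<exists>T. T \<subseteq> S j - {v} \<and> finite T \<and> card T = k" if "j \<in> J" for j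
      proof -
        have "k \<le> card (S j - {v})"
          using Suc.prems(3) that by (auto simp: card_Diff_singleton_if)
        then show ?thesis by (meson obtain_subset_with_card_n)
      qed
      then obtain S' where S': "\<forall>j\<in>J. S' j \<subseteq> S j - {v} \<and> finite (S' j) \<and> card (S' j) = k"
        by metis
      \<comment> \<open>The degree bound leaves at most
        \<open>m * ((k + 1)^2 - 2 * (k + 1)) = m * (k^2 - 1)\<close> on the left.\<close>
      have "real (card E') * (1 + real k)^2 \<le> m * real k ^ 2"
      proof -
        have "2 * real m \<le> (1 + real k) * card (nbrs E v)"
          using v by (metis of_nat_Suc of_nat_le_iff of_nat_mult of_nat_numeral add.commute)
        then have "(1 + real k) * (2 * real m) \<le> (1 + real k) * ((1 + real k) * card (nbrs E v))"
          by (intro mult_left_mono) auto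
        then show ?thesis
          using m unfolding cE' by (simp add: algebra_simps power2_eq_square)
      qed
      then have "2 * l * (real (card E') * (1 + real k)^2) \<le> 2 * l * (m * real k ^ 2)"
        using l0 by (intro mult_left_mono) auto
      also have "\<dots> = (2 * m * l) * real k ^ 2" by simp
      also have "\<dots> < (real (Suc k) ^ 2 * ln 3) * real k ^ 2"
        using small k by (intro mult_strict_right_mono) auto
      finally have "(2 * real (card E') * l) * (1 + real k)^2 < (real k ^ 2 * ln 3) * (1 + real k)^2"
        by (simp add: mult_ac)
      then have "2 * real (card E') * l < real k ^ 2 * ln 3"
        by (rule mult_right_less_imp_less) simp
      then have "\<exists>I. independent E' I \<and> (\<forall>j\<in>J. I \<inter> S' j \<noteq> {})"
        using Suc.prems S' by (intro Suc.IH) (auto simp: E'_def l_def)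
      then obtain I where I: "independent E' I" "\<forall>j\<in>J. I \<inter> S' j \<noteq> {}" by blast
      have "independent E (I - {v})"
        using I(1) by (auto simp: independent_def E'_def touching_def)
      moreover have "\<forall>j\<in>J. (I - {v}) \<inter> S j \<noteq> {}"
        using I(2) S' by blast
      ultimately show ?thesis by blast
    next
      case False
      define r where "r = real (Suc k) / m"
      have r: "r > 0" using m by (simp add: r_def)
      have deg: "\<forall>v. r * real (card (nbrs E v)) \<le> 2"
      proof
        fix v
        have "Suc k * card (nbrs E v) \<le> 2 * m" using False by (meson nat_le_linear)
        then have "real (Suc k) * card (nbrs E v) \<le> 2 * m"
          by (metis of_nat_le_iff of_nat_mult of_nat_numeral)
        then show "r * real (card (nbrs E v)) \<le> 2"
          using m by (simp add: r_def field_simps)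
      qed
      define W where "W = (\<Union>j\<in>J. S j)"
      define R where "R = W \<union> (\<Union>u\<in>W. nbrs E u)"
      have finW: "finite W" using J Suc.prems by (auto simp: W_def)
      have "pot r E (S j) \<le> exp (- (real (Suc k) ^ 2 * ln 3 / (2 * m)))" if "j \<in> J" for j
      proof -
        have "card (touching E (S j)) \<le> m"
          unfolding m_def using Suc.prems(1) by (intro card_mono) (auto simp: touching_def)
        then have "r\<^sup>2 / 3 * card (touching E (S j)) \<le> r\<^sup>2 / 3 * m"
          by (intro mult_left_mono) auto
        \<comment> \<open>For \<open>r = Suc k / m\<close> the two contributions of
          \<open>1/3\<close> cancel, and only the \<open>ln 3\<close> term is left.\<close>
        moreover have "r\<^sup>2 / 3 * m - r * (ln 3 + 2/3) / 2 * Suc k = - (real (Suc k) ^ 2 * ln 3 / (2 * m))"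
          using m unfolding r_def by (simp add: field_simps power2_eq_square)
        ultimately show ?thesis
          using Suc.prems(3) that by (simp add: pot_def)
      qed
      then have "(\<Sum>j\<in>J. pot r E (S j)) \<le> card J * exp (- (real (Suc k) ^ 2 * ln 3 / (2 * m)))"
        by (rule sum_bounded_above)
      also have "\<dots> = exp (l - real (Suc k) ^ 2 * ln 3 / (2 * m))"
      proof -
        have "real (card J) = exp l" using J by (simp add: l_def card_gt_0_iff)
        then show ?thesis by (simp add: exp_add[symmetric])
      qed
      also have "\<dots> < 1"
        using small m by (simp add: field_simps)
      finally have total: "(\<Sum>j\<in>J. pot r E (S j)) < 1" .
      have "\<exists>I\<subseteq>W. independent E I \<and> (\<forall>j\<in>J. I \<inter> S j \<noteq> {})"
      proof (rule independent_transversal_pot[OF Suc.prems(1,2) J(1) _ _ _ _ r deg total, where R = R])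
        show "finite R" using finW finite_nbrs[OF Suc.prems(1)] by (simp add: R_def)
      qed (auto simp: R_def W_def)
      then show ?thesis by blast
    qed
  qed
qed

section \<open>Choosability and the two bounds\<close>

text \<open>The colours in \<open>I\<close> are reserved for \<open>B\<close>, the others for
  \<open>A\<close>. Lists on \<open>A\<close> may coincide, so \<open>m\<close> only bounds the
  number of edges.\<close>

lemma K_choosable_2:
  assumes m: "m > 0" and n: "n > 0" and small: "2 * real m * ln (real n) < real k ^ 2 * ln 3"
  shows "K_choosable m n 2 k"
  unfolding K_choosable_def choosable_def choosable_over_def
proof (intro allI impI, elim conjE)
  fix C :: "nat set" and L :: "nat + nat \<Rightarrow> nat set"
  assume LA: "\<forall>v\<in>K_A m. L v \<in> [C]\<^bsup>2\<^esup>" and LB: "\<forall>v\<in>K_B n. L v \<in> [C]\<^bsup>k\<^esup>"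
  define E where "E = L ` K_A m"
  have "card E \<le> m"
    unfolding E_def K_A_def image_image
    using card_image_le[of "{..<m}" "\<lambda>x. L (Inl x)"] by simp
  then have "2 * real (card E) * ln (real n) \<le> 2 * real m * ln (real n)"
    using n by (intro mult_right_mono) auto
  then have "\<exists>I. independent E I \<and> (\<forall>j\<in>{..<n}. I \<inter> L (Inr j) \<noteq> {})"
    using LA LB small n
    by (intro independent_transversal[where k = k])
       (auto simp: E_def K_A_def K_B_def nsets_def)
  then obtain I where I: "independent E I" "\<forall>v\<in>K_B n. I \<inter> L v \<noteq> {}"
    by (auto simp: K_B_def)
  define c where
    "c v = (if v \<in> K_A m then SOME x. x \<in> L v - I else SOME x. x \<in> L v \<inter> I)" for v
  have cA: "c v \<in> L v - I" if "v \<in> K_A m" for v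
  proof -
    have "\<exists>x. x \<in> L v - I"
      using I(1) that by (auto simp: independent_def E_def)
    then show ?thesis
      unfolding c_def using that by (metis (mono_tags, lifting) someI_ex)
  qed
  have cB: "c v \<in> L v \<inter> I" if "v \<in> K_B n" for v
  proof -
    have "v \<notin> K_A m" using that by (auto simp: K_A_def K_B_def)
    moreover have "\<exists>x. x \<in> L v \<inter> I" using I(2) that by blast
    ultimately show ?thesis
      unfolding c_def by (metis (mono_tags, lifting) someI_ex)
  qed
  have "c v \<noteq> c v'" if edge: "{v, v'} \<in> K_edges m n" for v v'
  proof -
    from edge obtain a b where "{v, v'} = {a, b}" "a \<in> K_A m" "b \<in> K_B n"
      unfolding K_edges_def by blast
    then show ?thesis using cA[of a] cB[of b] by (auto simp: doubleton_eq_iff)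
  qed
  then show "\<exists>c. (\<forall>v\<in>K_A m \<union> K_B n. c v \<in> L v) \<and> (\<forall>v v'. {v, v'} \<in> K_edges m n \<longrightarrow> c v \<noteq> c v')"
    using cA cB by (intro exI[of _ c]) auto
qed

text \<open>The lists \<open>{0, 1}\<close> on \<open>A\<close> and \<open>{0}\<close>,
  \<open>{1}\<close> on \<open>B\<close> admit no proper colouring.\<close>

lemma not_K_choosable_1_2: "\<not> K_choosable 1 2 2 1"
proof
  assume ch: "K_choosable 1 2 2 1"
  define L :: "nat + nat \<Rightarrow> nat set" where "L = case_sum (\<lambda>_. {..<2}) (\<lambda>j. {j})"
  have lists: "(\<forall>v\<in>K_A 1. L v \<in> [UNIV]\<^bsup>2\<^esup>) \<and> (\<forall>v\<in>K_B 2. L v \<in> [UNIV]\<^bsup>1\<^esup>)"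
    by (auto simp: K_A_def K_B_def L_def nsets_def)
  have "\<exists>c. (\<forall>v\<in>K_A 1 \<union> K_B 2. c v \<in> L v) \<and> (\<forall>v v'. {v, v'} \<in> K_edges 1 2 \<longrightarrow> c v \<noteq> c v')"
    by (rule ch[unfolded K_choosable_def choosable_def choosable_over_def,
          THEN spec, THEN spec, THEN mp, OF lists])
  then obtain c where c: "\<forall>v\<in>K_A 1 \<union> K_B 2. c v \<in> L v"
    and proper: "\<forall>v v'. {v, v'} \<in> K_edges 1 2 \<longrightarrow> c v \<noteq> c v'"
    by (elim exE conjE)
  define j where "j = c (Inl 0)"
  have "c (Inl 0) \<in> L (Inl 0)" using c by (simp add: K_A_def)
  then have j: "j < 2" by (simp add: j_def L_def)
  then have "c (Inr j) \<in> L (Inr j)" using c by (simp add: K_B_def)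
  then have "c (Inr j) = j" by (simp add: L_def)
  moreover have "{Inl 0, Inr j} \<in> K_edges 1 2"
    using j unfolding K_edges_def K_A_def K_B_def by blast
  ultimately show False using proper by (metis j_def)
qed

theorem theorem1p8: "1 / 2 * ln 3 \<le> xi_m 2 \<and> xi_m 2 \<le> ln 2"
proof
  show "1 / 2 * ln 3 \<le> xi_m 2"
    unfolding xi_m_def
  proof (rule cInf_greatest)
    show "xi_m_values 2 \<noteq> {}" by (rule xi_m_values_nonempty) simp
  next
    fix x assume "x \<in> xi_m_values 2"
    then obtain n m k where x: "x = real m * ln (real n) / real k ^ 2"
      and pos: "n > 0" "m > 0" "k > 0" and nch: "\<not> K_choosable m n 2 k"
      by (auto simp: xi_m_values_def)
    have "real k ^ 2 * ln 3 \<le> 2 * real m * ln (real n)"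
      using K_choosable_2[OF pos(2,1)] nch not_le by blast
    then show "1 / 2 * ln 3 \<le> x"
      using pos by (simp add: x field_simps)
  qed
  have "ln 2 \<in> xi_m_values 2"
    unfolding xi_m_values_def using not_K_choosable_1_2 by (intro CollectI exI[of _ 2] exI[of _ 1]) auto
  then show "xi_m 2 \<le> ln 2"
    unfolding xi_m_def by (intro cInf_lower bdd_below_xi_m_values)
qed

end
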